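(* Let $S = [A_1, \dots, A_{d+1}]$ be a non-regular, non-rectangular, equiradial orthocentric $d$-simplex, and let $a_1, \dots, a_{d+1}$ be the barycentric coordinates of its orthocenter with respect to $S$. Then there are two possibilities: (1) $S$ is a kite of eccentricity $\sqrt{(d-2)/d}$, in which case $d \ge 5$; or (2) there exists an $m$ with $2 \le m \le d-1$ such that, after relabelling vertices, $$a_1 = \dots = a_m, \qquad a_{m+1} = \dots = a_{d+1},$$ where $$m(d+1-m) \le \left(\frac{d^2-3d+4}{2(d-2)}\right)^2,$$ and in this case $d \ge 9$.
   Context: A $d$-simplex in $\mathbb{E}^d$ is the convex hull of $d+1$ affinely independent points. $S$ is orthocentric if its altitudes (lines through each vertex perpendicular to the hyperplane of the opposite facet) have a common point, the orthocenter $H$; it is rectangular if $H$ is one of its vertices. Barycentric coordinates of $H$: the unique reals with $H=\sum a_iA_i$, $\sum a_i=1$. $S$ is regular if all edges have the same length, and equiradial if all its facets ($(d-1)$-faces) have equal circumradii. A $d$-kite is a $d$-simplex in which $d$ of the vertices form a regular $(d-1)$-simplex $T$ (the base), of edge-length $s$, and are all at the same distance $t$ from the remaining vertex (the apex); its eccentricity is $t/s$. *)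

theory Defs
  imports "HOL-Analysis.Analysis"
begin

text \<open>
  A simplex is represented by its vertex set \<open>V\<close>, a finite affinely independent set; its facets
  are then represented by the sets \<open>V - {v}\<close> with \<open>v \<in> V\<close>.
\<close>

text \<open>
  This set is a line when \<open>V\<close> has \<open>DIM('a) + 1\<close> elements.
\<close>

definition altitude :: "'a::euclidean_space set \<Rightarrow> 'a \<Rightarrow> 'a set" where
  "altitude V v = {x. \<forall>y \<in> affine hull (V - {v}). \<forall>z \<in> affine hull (V - {v}).
                       orthogonal (x - v) (y - z)}"

text \<open>
  The orthocenter is kept as a relation; it is unique for simplices of dimension at least 2
  (for a segment both altitudes coincide with the whole line).
\<close>

definition is_orthocenter :: "'a::euclidean_space set \<Rightarrow> 'a \<Rightarrow> bool" where
  "is_orthocenter V H \<longleftrightarrow> (\<forall>v\<in>V. H \<in> altitude V v)"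

definition orthocentric :: "'a::euclidean_space set \<Rightarrow> bool" where
  "orthocentric V \<longleftrightarrow> (\<exists>H. is_orthocenter V H)"

definition rectangular :: "'a::euclidean_space set \<Rightarrow> bool" where
  "rectangular V \<longleftrightarrow> (\<exists>H\<in>V. is_orthocenter V H)"

definition regular_of_edge_length :: "'a::euclidean_space set \<Rightarrow> real \<Rightarrow> bool" where
  "regular_of_edge_length V s \<longleftrightarrow> (\<forall>x\<in>V. \<forall>y\<in>V. x \<noteq> y \<longrightarrow> dist x y = s)"

definition regular_simplex :: "'a::euclidean_space set \<Rightarrow> bool" where
  "regular_simplex V \<longleftrightarrow> (\<exists>s. regular_of_edge_length V s)"

text \<open>
  The circumsphere of a simplex that is not full-dimensional is taken inside its affine hull;
  the center and the radius are then unique.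
\<close>

definition has_circumradius :: "'a::euclidean_space set \<Rightarrow> real \<Rightarrow> bool" where
  "has_circumradius W r \<longleftrightarrow> (\<exists>c \<in> affine hull W. \<forall>w\<in>W. dist c w = r)"

definition equiradial :: "'a::euclidean_space set \<Rightarrow> bool" where
  "equiradial V \<longleftrightarrow> (\<exists>r. \<forall>v\<in>V. has_circumradius (V - {v}) r)"

text \<open>
  Here \<open>p\<close> is the apex, \<open>V - {p}\<close> the base, \<open>s\<close> the edge length of the base and \<open>t\<close> the distance
  from the apex to the vertices of the base.
\<close>

definition is_kite :: "'a::euclidean_space set \<Rightarrow> 'a \<Rightarrow> real \<Rightarrow> real \<Rightarrow> bool" where
  "is_kite V p s t \<longleftrightarrow>
     p \<in> V \<and> 0 < s \<and> regular_of_edge_length (V - {p}) s \<and> (\<forall>x\<in>V - {p}. dist p x = t)"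

definition kite_of_eccentricity :: "'a::euclidean_space set \<Rightarrow> real \<Rightarrow> bool" where
  "kite_of_eccentricity V e \<longleftrightarrow> (\<exists>p s t. is_kite V p s t \<and> e = t / s)"

end

theory Submission
  imports Defs
begin

text \<open>
  Put the origin at the orthocenter \<open>H\<close> and write \<open>u\<^sub>i = A\<^sub>i - H\<close>. The altitude conditions say that
  all inner products \<open>u\<^sub>i \<bullet> u\<^sub>j\<close> with \<open>i \<noteq> j\<close> have one common value \<open>c\<close>
  (\<open>orthocenter_inner_const\<close>), and \<open>c \<noteq> 0\<close> because the simplex is not rectangular. So the Gram
  matrix is a constant matrix plus a diagonal one with entries \<open>q\<^sub>i = \<bar>u\<^sub>i\<bar>\<^sup>2 - c\<close>, and metric
  quantities are elementary in the \<open>q\<^sub>i\<close>; for instance \<open>\<bar>A\<^sub>i - A\<^sub>j\<bar>\<^sup>2 = q\<^sub>i + q\<^sub>j\<close>. Pairing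
  \<open>\<Sum> a\<^sub>i u\<^sub>i = 0\<close> with \<open>u\<^sub>j\<close> gives \<open>a\<^sub>j q\<^sub>j = - c\<close>. So every \<open>a\<^sub>j\<close> is nonzero, and none is 1
  because no vertex is the orthocenter.

  The circumradius \<open>r\<close> of the facet opposite \<open>A\<^sub>k\<close> (\<open>circumradius_const_inner\<close>) satisfies
  \<open>4 r\<^sup>2 = \<Sum> q\<^sub>i + c (1 / a\<^sub>k + (d - 2)\<^sup>2 / (1 - a\<^sub>k))\<close>, with the sum over all vertices. Equiradiality therefore says that
  \<open>1 / a\<^sub>k + (d - 2)\<^sup>2 / (1 - a\<^sub>k)\<close> is the same for all \<open>k\<close>. Two different values \<open>x\<close>, \<open>y\<close> among the
  coordinates must satisfy \<open>(d - 2)\<^sup>2 x y = (1 - x) (1 - y)\<close>, and no three different reals satisfy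
  this pairwise. As the simplex is not regular, exactly two values occur, with multiplicities \<open>m\<close> and
  \<open>k = d + 1 - m\<close>, and \<open>m x + k y = 1\<close>.

  If one multiplicity is 1, the simplex is a kite, and these two equations determine \<open>x\<close> and \<open>y\<close> and
  hence the eccentricity (\<open>kite_ratio\<close>). Otherwise each value occurs at least twice, so that all \<open>q\<^sub>i\<close> are
  positive and \<open>x y > 0\<close>. Then the two equations combine to a quadratic form identity to which the
  inequality of arithmetic and geometric means applies (\<open>two_value_bounds\<close>); this bounds
  \<open>m k\<close> and, with \<open>m k \<ge> 2 (d - 1)\<close>, forces \<open>d \<ge> 9\<close>.
\<close>

section \<open>Vectors with constant pairwise inner products\<close>

text \<open>
  The altitude through \<open>A i\<close> makes row \<open>i\<close> of the Gram matrix constant off the diagonal. By symmetry of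
  the matrix, different rows have the same constant as soon as there are three of them; with only two
  vertices there is nothing to compare.
\<close>

lemma orthocenter_inner_const:
  fixes A :: "'i \<Rightarrow> 'a::euclidean_space"
  assumes inj: "inj_on A I" and card: "3 \<le> card I" and oc: "is_orthocenter (A ` I) H"
  obtains c where "\<And>i j. i \<in> I \<Longrightarrow> j \<in> I \<Longrightarrow> i \<noteq> j \<Longrightarrow> (A i - H) \<bullet> (A j - H) = c"
proof -
  let ?g = "\<lambda>i j. (A i - H) \<bullet> (A j - H)"
  have row: "?g i j = ?g i k"
    if "i \<in> I" "j \<in> I" "k \<in> I" "j \<noteq> i" "k \<noteq> i" for i j k
  proof -
    have "A j \<in> A ` I - {A i}" "A k \<in> A ` I - {A i}"
      using that inj by (auto dest: inj_onD)
    then have "A j \<in> affine hull (A ` I - {A i})" "A k \<in> affine hull (A ` I - {A i})"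
      by (auto intro: hull_inc)
    then have "(H - A i) \<bullet> (A j - A k) = 0"
      using oc that(1) by (auto simp: is_orthocenter_def altitude_def orthogonal_def)
    then show ?thesis by (simp add: inner_simps inner_commute)
  qed
  have sym: "?g i j = ?g j i" for i j by (rule inner_commute)
  obtain T where T: "T \<subseteq> I" "card T = 3" using card by (meson obtain_subset_with_card_n)
  then obtain p q s where pqs: "T = {p, q, s}" "p \<noteq> q" "q \<noteq> s" "p \<noteq> s"
    by (auto simp: card_3_iff)
  then have mem: "p \<in> I" "q \<in> I" "s \<in> I" using T by auto
  have from_p: "?g p j = ?g p q" if "j \<in> I" "j \<noteq> p" for j
    using row[of p j q] that mem pqs by auto
  have "?g i j = ?g p q" if ij: "i \<in> I" "j \<in> I" "i \<noteq> j" for i j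
  proof (cases "i = p")
    case True
    then show ?thesis using from_p[of j] ij by simp
  next
    case False
    then have "?g i j = ?g i p" using row[of i j p] ij mem by auto
    then show ?thesis using from_p[of i] False ij sym[of i p] by simp
  qed
  then show thesis by (rule that)
qed

lemma inner_affine_combination:
  fixes u :: "'i \<Rightarrow> 'a::real_inner"
  assumes fin: "finite J"
    and const: "\<And>i j. i \<in> J \<Longrightarrow> j \<in> J \<Longrightarrow> i \<noteq> j \<Longrightarrow> u i \<bullet> u j = c"
    and sum_b: "(\<Sum>i\<in>J. b i) = 1" and j: "j \<in> J"
  shows "(\<Sum>i\<in>J. b i *\<^sub>R u i) \<bullet> u j = c + b j * (u j \<bullet> u j - c)"
proof -
  have "(\<Sum>i\<in>J. b i *\<^sub>R u i) \<bullet> u j = (\<Sum>i\<in>J. b i * (u i \<bullet> u j))"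
    by (simp add: inner_sum_left)
  also have "\<dots> = (\<Sum>i\<in>J. b i * c + (if i = j then b j * (u j \<bullet> u j - c) else 0))"
    using const j by (intro sum.cong) (auto simp: algebra_simps)
  also have "\<dots> = c + b j * (u j \<bullet> u j - c)"
    using fin j sum_b by (simp add: sum.distrib flip: sum_distrib_right)
  finally show ?thesis .
qed

text \<open>
  Here \<open>p\<close> is the circumcenter, an affine combination of the vertices. As \<open>p \<bullet> u\<^sub>i = c + b\<^sub>i q\<^sub>i\<close>, the
  equation \<open>\<bar>p - u\<^sub>i\<bar> = r\<close> involves no other coefficient and reads \<open>(1 - 2 b\<^sub>i) q\<^sub>i = E\<close> with \<open>E\<close> independent of \<open>i\<close>; summing
  \<open>1 - 2 b\<^sub>i = E / q\<^sub>i\<close> gives \<open>E \<Sum> 1 / q\<^sub>i = card J - 2\<close>, which serves to evaluate \<open>\<bar>p\<bar>\<^sup>2\<close>. The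
  result is multiplied by \<open>\<Sum> 1 / q\<^sub>i\<close> to avoid a division.
\<close>

lemma circumradius_const_inner:
  fixes u :: "'i \<Rightarrow> 'a::real_inner" and J :: "'i set" and c :: real
  defines "q \<equiv> \<lambda>i. (norm (u i))\<^sup>2 - c"
  assumes fin: "finite J"
    and const: "\<And>i j. i \<in> J \<Longrightarrow> j \<in> J \<Longrightarrow> i \<noteq> j \<Longrightarrow> u i \<bullet> u j = c"
    and q: "\<And>i. i \<in> J \<Longrightarrow> q i \<noteq> 0"
    and sum_b: "(\<Sum>i\<in>J. b i) = 1"
    and p: "p = (\<Sum>i\<in>J. b i *\<^sub>R u i)"
    and r: "\<And>i. i \<in> J \<Longrightarrow> norm (p - u i) = r"
  shows "4 * r\<^sup>2 * (\<Sum>i\<in>J. 1 / q i)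
         = (\<Sum>i\<in>J. 1 / q i) * (\<Sum>i\<in>J. q i) - (real (card J) - 2)\<^sup>2"
proof -
  let ?n = "real (card J)"
  define h Q E where "h = (\<Sum>i\<in>J. 1 / q i)" and "Q = (\<Sum>i\<in>J. q i)"
    and "E = r\<^sup>2 - (norm p)\<^sup>2 + c"
  have pu: "p \<bullet> u i = c + b i * q i" if "i \<in> J" for i
    using inner_affine_combination[OF fin const sum_b that] that
    by (simp add: p q_def power2_norm_eq_inner)
  have bq: "(1 - 2 * b i) * q i = E" if "i \<in> J" for i
  proof -
    have "r\<^sup>2 = (norm p)\<^sup>2 - 2 * (p \<bullet> u i) + (norm (u i))\<^sup>2"
      using r[OF that] by (simp add: power2_norm_eq_inner inner_simps inner_commute flip: r[OF that])
    then show ?thesis using pu[OF that] by (simp add: E_def q_def algebra_simps)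
  qed
  have Eh: "E * h = ?n - 2"
  proof -
    have "E * h = (\<Sum>i\<in>J. 1 - 2 * b i)"
      unfolding h_def sum_distrib_left
      by (intro sum.cong refl) (use bq q in \<open>force simp: field_simps\<close>)
    then show ?thesis using sum_b by (simp add: sum_subtractf flip: sum_distrib_left)
  qed
  have norm_p: "(norm p)\<^sup>2 = c + (\<Sum>i\<in>J. (b i)\<^sup>2 * q i)"
  proof -
    have "(norm p)\<^sup>2 = p \<bullet> (\<Sum>i\<in>J. b i *\<^sub>R u i)"
      unfolding power2_norm_eq_inner p ..
    also have "\<dots> = (\<Sum>i\<in>J. b i * c + (b i)\<^sup>2 * q i)"
      unfolding inner_sum_right
      by (intro sum.cong refl) (use pu in \<open>simp add: algebra_simps power2_eq_square\<close>)
    also have "\<dots> = c + (\<Sum>i\<in>J. (b i)\<^sup>2 * q i)"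
      using sum_b by (simp add: sum.distrib flip: sum_distrib_right)
    finally show ?thesis .
  qed
  have "4 * (\<Sum>i\<in>J. (b i)\<^sup>2 * q i) = (\<Sum>i\<in>J. q i - 2 * E + E\<^sup>2 * (1 / q i))"
    unfolding sum_distrib_left
  proof (intro sum.cong refl)
    fix i assume i: "i \<in> J"
    have "E\<^sup>2 * (1 / q i) = (1 - 2 * b i)\<^sup>2 * q i"
      using q[OF i] by (simp flip: bq[OF i]) (simp add: field_simps power2_eq_square)
    then show "4 * ((b i)\<^sup>2 * q i) = q i - 2 * E + E\<^sup>2 * (1 / q i)"
      by (simp flip: bq[OF i]) (simp add: algebra_simps power2_eq_square)
  qed
  also have "\<dots> = Q - 2 * ?n * E + E * (E * h)"
    unfolding sum.distrib sum_subtractf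
    unfolding sum_distrib_left[symmetric] by (simp add: Q_def h_def power2_eq_square)
  finally have "4 * (\<Sum>i\<in>J. (b i)\<^sup>2 * q i) = Q - (?n + 2) * E"
    unfolding Eh by (simp add: algebra_simps)
  moreover have "r\<^sup>2 = E + (\<Sum>i\<in>J. (b i)\<^sup>2 * q i)"
    using norm_p by (simp add: E_def)
  ultimately have "4 * r\<^sup>2 = Q - (?n - 2) * E"
    by (simp add: algebra_simps)
  then have "4 * r\<^sup>2 * h = (Q - (?n - 2) * E) * h"
    by simp
  also have "\<dots> = h * Q - (?n - 2) * (E * h)"
    by (simp add: algebra_simps)
  finally show ?thesis unfolding Eh by (simp add: h_def Q_def power2_eq_square)
qed

lemma affine_hull_image_translated:
  fixes A :: "'i \<Rightarrow> 'a::real_vector"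
  assumes fin: "finite J" and inj: "inj_on A J" and x: "x \<in> affine hull (A ` J)"
  obtains b where "(\<Sum>i\<in>J. b i) = 1" "x - H = (\<Sum>i\<in>J. b i *\<^sub>R (A i - H))"
proof -
  obtain w where w: "sum w (A ` J) = 1" "(\<Sum>v\<in>A ` J. w v *\<^sub>R v) = x"
    using x fin by (auto simp: affine_hull_finite)
  let ?b = "\<lambda>i. w (A i)"
  have b: "(\<Sum>i\<in>J. ?b i) = 1" "(\<Sum>i\<in>J. ?b i *\<^sub>R A i) = x"
    using w inj by (simp_all add: sum.reindex)
  have "(\<Sum>i\<in>J. ?b i *\<^sub>R (A i - H)) = x - H"
    using b by (simp add: scaleR_diff_right sum_subtractf flip: scaleR_sum_left)
  then show thesis using b(1) by (intro that[of ?b]) auto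
qed

section \<open>Two values of the barycentric coordinates\<close>

text \<open>
  With the denominator \<open>1 - t\<close> cleared, the last two premises say that \<open>1 / t + s / (1 - t)\<close> equals
  \<open>(R - Q) / c\<close> at \<open>t = x\<close> and at \<open>t = y\<close>; the conclusion is what remains of the
  difference after division by \<open>x - y\<close>. In the application \<open>R = 4 r\<^sup>2\<close>, \<open>Q = \<Sum> q\<^sub>i\<close> and \<open>s = (d - 2)\<^sup>2\<close>.
\<close>

lemma equiradial_value_relation:
  fixes c s R Q x y :: real
  assumes c: "c \<noteq> 0" and "x \<noteq> 0" "y \<noteq> 0" "x \<noteq> y"
    and fx: "R * (1 - x) = (1 - x) * (Q + c / x) + c * s"
    and fy: "R * (1 - y) = (1 - y) * (Q + c / y) + c * s"
  shows "s * x * y = (1 - x) * (1 - y)"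
proof -
  have X: "(R - Q) * (1 - x) * x = c * (1 - x + s * x)"
    using fx \<open>x \<noteq> 0\<close> by (simp add: field_simps)
  have Y: "(R - Q) * (1 - y) * y = c * (1 - y + s * y)"
    using fy \<open>y \<noteq> 0\<close> by (simp add: field_simps)
  have "c * ((1 - x + s * x) * ((1 - y) * y) - (1 - y + s * y) * ((1 - x) * x)) = 0"
    using X Y by algebra
  moreover have "(1 - x + s * x) * ((1 - y) * y) - (1 - y + s * y) * ((1 - x) * x)
                 = (y - x) * ((1 - x) * (1 - y) - s * x * y)"
    by (simp add: algebra_simps)
  ultimately have "(y - x) * ((1 - x) * (1 - y) - s * x * y) = 0"
    using c by simp
  then show ?thesis using \<open>x \<noteq> y\<close> by simp
qed

text \<open>
  For fixed \<open>x\<close> the relation is linear in the other value, so two solutions force its slope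
  \<open>s x + 1 - x\<close> to vanish; this cannot happen at two different points.
\<close>

lemma equiradial_at_most_two_values:
  fixes s x y z :: real
  assumes "x \<noteq> y" "x \<noteq> z" "y \<noteq> z"
    and xy: "s * x * y = (1 - x) * (1 - y)"
    and xz: "s * x * z = (1 - x) * (1 - z)"
    and yz: "s * y * z = (1 - y) * (1 - z)"
  shows False
proof -
  have "(y - z) * (s * x + 1 - x) = 0" using xy xz by algebra
  then have X: "s * x + 1 - x = 0" using \<open>y \<noteq> z\<close> by simp
  have "(x - z) * (s * y + 1 - y) = 0" using xy yz by algebra
  then have Y: "s * y + 1 - y = 0" using \<open>x \<noteq> z\<close> by simp
  have "(x - y) * (s - 1) = 0" using X Y by algebra
  then show False using X \<open>x \<noteq> y\<close> by simp
qed

text \<open>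
  Substituting \<open>1 - x = d y\<close> makes the relation divisible by \<open>y\<close> and leaves linear equations, with
  solution \<open>x = 1 / (d - 3)\<close> and \<open>y = (d - 4) / (d (d - 3))\<close>. The degenerate dimensions \<open>d \<le> 4\<close>
  would need a coordinate 0 or 1, or have no solution.
\<close>

lemma kite_ratio:
  fixes x y :: real and d :: nat
  assumes d: "2 \<le> d" and nz: "x \<noteq> 0" "y \<noteq> 0" and n1: "x \<noteq> 1" "y \<noteq> 1"
    and sum: "x + real d * y = 1"
    and rel: "(real d - 2)\<^sup>2 * x * y = (1 - x) * (1 - y)"
  shows "5 \<le> d" "y / x = (real d - 4) / real d"
proof -
  let ?d = "real d"
  have x: "x = 1 - ?d * y" using sum by simp
  have "y * ((?d - 2)\<^sup>2 * x - ?d * (1 - y)) = 0"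
    using rel x by algebra
  then have "(?d - 2)\<^sup>2 * x = ?d * (1 - y)" using nz by simp
  then have "(?d - 1) * (?d * (?d - 3) * y) = (?d - 1) * (?d - 4)" using x by algebra
  then have y: "?d * (?d - 3) * y = ?d - 4" using d by simp
  show "5 \<le> d"
  proof (rule ccontr)
    assume "\<not> 5 \<le> d"
    then have "d = 2 \<or> d = 3 \<or> d = 4" using d by auto
    then show False using y rel nz n1 by auto
  qed
  then have d5: "5 \<le> ?d" by simp
  have "(?d - 3) * x = 1" using x y by algebra
  then have "?d * y * ((?d - 3) * x) = (?d - 4) * x" using y by algebra
  then have "?d * y = (?d - 4) * x" using \<open>(?d - 3) * x = 1\<close> by simp
  then show "y / x = (?d - 4) / ?d" using nz d5 by (simp add: field_simps)
qed

text \<open>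
  Writing 1 as \<open>m x + k y\<close> in the relation makes it homogeneous, namely
  \<open>m (m - 1) x\<^sup>2 + k (k - 1) y\<^sup>2 = (D - 2 m k) x y\<close> with \<open>D = d\<^sup>2 - 3 d + 4\<close>. The left side is
  positive, which gives the first bound. By the inequality of arithmetic and geometric means
  \<open>4 m k (m - 1) (k - 1) \<le> (D - 2 m k)\<^sup>2\<close>, where \<open>(m - 1) (k - 1) = m k - d\<close>, and the quadratic
  terms in \<open>m k\<close> cancel; the second bound is left because \<open>D - d = (d - 2)\<^sup>2\<close>.
\<close>

lemma two_value_bounds:
  fixes x y m k d :: real
  assumes mk: "2 \<le> m" "2 \<le> k" "m + k = d + 1"
    and pos: "0 < x * y"
    and sum: "m * x + k * y = 1"
    and rel: "(d - 2)\<^sup>2 * x * y = (1 - x) * (1 - y)"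
  shows "2 * (m * k) < d\<^sup>2 - 3 * d + 4"
    and "4 * (m * k) * (d - 2)\<^sup>2 \<le> (d\<^sup>2 - 3 * d + 4)\<^sup>2"
proof -
  let ?D = "d\<^sup>2 - 3 * d + 4"
  have nz: "x \<noteq> 0" "y \<noteq> 0" using pos by auto
  have d: "d = m + k - 1" using mk by simp
  have "1 - x = (m - 1) * x + k * y" "1 - y = m * x + (k - 1) * y"
    using sum by (simp_all add: algebra_simps)
  then have "(d - 2)\<^sup>2 * x * y = ((m - 1) * x + k * y) * (m * x + (k - 1) * y)"
    using rel by simp
  then have quad: "m * (m - 1) * x\<^sup>2 + k * (k - 1) * y\<^sup>2 = (?D - 2 * (m * k)) * (x * y)"
    unfolding d by (simp add: algebra_simps power2_eq_square)
  have "0 < m * (m - 1) * x\<^sup>2 + k * (k - 1) * y\<^sup>2"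
    using mk nz by (intro add_pos_pos mult_pos_pos) auto
  then show lt: "2 * (m * k) < ?D"
    using pos unfolding quad by (simp add: zero_less_mult_iff)
  have "4 * (m * (m - 1) * x\<^sup>2) * (k * (k - 1) * y\<^sup>2)
        \<le> (m * (m - 1) * x\<^sup>2 + k * (k - 1) * y\<^sup>2)\<^sup>2"
    using zero_le_power2[of "m * (m - 1) * x\<^sup>2 - k * (k - 1) * y\<^sup>2"]
    by (simp add: power2_eq_square algebra_simps)
  then have "4 * (m * (m - 1)) * (k * (k - 1)) * (x * y)\<^sup>2 \<le> (?D - 2 * (m * k))\<^sup>2 * (x * y)\<^sup>2"
    unfolding quad power_mult_distrib by (simp only: mult_ac)
  then have "4 * (m * (m - 1)) * (k * (k - 1)) \<le> (?D - 2 * (m * k))\<^sup>2"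
    using nz by (simp add: mult_le_cancel_right)
  then show "4 * (m * k) * (d - 2)\<^sup>2 \<le> ?D\<^sup>2"
    unfolding d by (simp add: algebra_simps power2_eq_square)
qed

text \<open>
  The product \<open>m (d + 1 - m)\<close> is at least its value \<open>2 (d - 1)\<close> at the ends of the range of \<open>m\<close>. The
  second bound then fails for \<open>4 \<le> d \<le> 8\<close>; for \<open>d = 3\<close> it holds with equality, and there the
  first bound is violated.
\<close>

lemma two_value_dim_ge_9:
  fixes m d :: nat
  assumes m: "2 \<le> m" "m \<le> d - 1"
    and lt: "2 * (real m * (real d + 1 - real m)) < (real d)\<^sup>2 - 3 * real d + 4"
    and le: "4 * (real m * (real d + 1 - real m)) * (real d - 2)\<^sup>2
             \<le> ((real d)\<^sup>2 - 3 * real d + 4)\<^sup>2"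
  shows "9 \<le> d"
proof (rule ccontr)
  assume "\<not> 9 \<le> d"
  then have cases: "d = 3 \<or> d = 4 \<or> d = 5 \<or> d = 6 \<or> d = 7 \<or> d = 8" using m by auto
  have "0 \<le> (real m - 2) * (real d - 1 - real m)" using m by (intro mult_nonneg_nonneg) auto
  then have P: "2 * (real d - 1) \<le> real m * (real d + 1 - real m)" by (simp add: algebra_simps)
  then have "4 * (2 * (real d - 1)) * (real d - 2)\<^sup>2
             \<le> 4 * (real m * (real d + 1 - real m)) * (real d - 2)\<^sup>2"
    by (intro mult_right_mono mult_left_mono) auto
  with le have "4 * (2 * (real d - 1)) * (real d - 2)\<^sup>2 \<le> ((real d)\<^sup>2 - 3 * real d + 4)\<^sup>2"
    by linarith
  moreover have "4 * (real d - 1) < (real d)\<^sup>2 - 3 * real d + 4" using P lt by linarith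
  ultimately show False using cases by auto
qed

section \<open>Equiradial orthocentric simplices\<close>

lemma permutes_initial_segment:
  assumes "M \<subseteq> {1..n}" and m: "card M = m"
  obtains \<pi> where "\<pi> permutes {1..n}" "\<pi> ` {1..m} = M" "\<pi> ` {m + 1..n} = {1..n} - M"
proof -
  have fin: "finite M" using assms finite_subset by blast
  have mn: "m \<le> n" using assms card_mono[of "{1..n}" M] by simp
  obtain f where f: "bij_betw f {1..m} M"
    using fin m by (metis ex_bij_betw_nat_finite_1)
  have "card {m + 1..n} = card ({1..n} - M)"
    using assms fin mn by (simp add: card_Diff_subset)
  then obtain g where g: "bij_betw g {m + 1..n} ({1..n} - M)"
    by (metis finite_atLeastAtMost finite_Diff finite_same_card_bij)
  define \<pi> where "\<pi> i = (if i \<in> {1..m} then f i else if i \<in> {m + 1..n} then g i else i)" for i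
  have f': "bij_betw \<pi> {1..m} M"
    using f by (rule bij_betw_cong[THEN iffD1, rotated]) (auto simp: \<pi>_def)
  have g': "bij_betw \<pi> {m + 1..n} ({1..n} - M)"
    using g by (rule bij_betw_cong[THEN iffD1, rotated]) (auto simp: \<pi>_def)
  have "{1..m} \<union> {m + 1..n} = {1..n}" using mn by auto
  then have "bij_betw \<pi> {1..n} {1..n}"
    using bij_betw_combine[OF f' g'] assms(1) by (simp add: Un_absorb1)
  then have "\<pi> permutes {1..n}"
    using mn by (intro bij_imp_permutes) (auto simp: \<pi>_def)
  then show thesis using f' g' by (intro that[of \<pi>]) (auto simp: bij_betw_def)
qed

theorem theorem4p11:
  fixes A :: "nat \<Rightarrow> 'a::euclidean_space"
    and V :: "'a set"
    and H :: 'a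
    and a :: "nat \<Rightarrow> real"
    and d :: nat
  assumes dim: "DIM('a) = d"
    and vertices: "V = A ` {1..d + 1}"
    and distinct_vertices: "inj_on A {1..d + 1}"
    and simplex: "\<not> affine_dependent V"
    and nonregular: "\<not> regular_simplex V"
    and nonrectangular: "\<not> rectangular V"
    and equiradial: "equiradial V"
    and orthocentric: "orthocentric V"
    and orthocenter: "is_orthocenter V H"
    and barycentric: "H = (\<Sum>i=1..d + 1. a i *\<^sub>R A i)" "(\<Sum>i=1..d + 1. a i) = 1"
  shows "(kite_of_eccentricity V (sqrt ((real d - 2) / real d)) \<and> d \<ge> 5) \<or>
         (\<exists>m. 2 \<le> m \<and> m \<le> d - 1 \<and>
            (\<exists>\<pi>. \<pi> permutes {1..d + 1} \<and>
               (\<forall>i\<in>{1..m}. a (\<pi> i) = a (\<pi> 1)) \<and>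
               (\<forall>i\<in>{m + 1..d + 1}. a (\<pi> i) = a (\<pi> (m + 1)))) \<and>
            real m * (real d + 1 - real m)
              \<le> (((real d)\<^sup>2 - 3 * real d + 4) / (2 * (real d - 2)))\<^sup>2 \<and>
            d \<ge> 9)"
proof -
  define I where "I = {1..d + 1}"
  have finI: "finite I" and cardI: "card I = d + 1" by (simp_all add: I_def)
  have injI: "inj_on A I" and VI: "V = A ` I" using distinct_vertices vertices by (simp_all add: I_def)
  have sum_a: "(\<Sum>i\<in>I. a i) = 1" using barycentric(2) by (simp add: I_def)
  define u where "u i = A i - H" for i
  have d2: "2 \<le> d"
  proof (rule ccontr)
    assume "\<not> 2 \<le> d"
    then have "d = 0 \<or> d = 1" by auto
    then have "V = {A 1} \<or> V = {A 1, A 2}"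
      using vertices by (auto simp: numeral_2_eq_2 atLeastAtMostSuc_conv)
    then have "regular_of_edge_length V (dist (A 1) (A 2))"
      by (auto simp: regular_of_edge_length_def dist_commute)
    then show False using nonregular by (auto simp: regular_simplex_def)
  qed
  obtain c where c: "u i \<bullet> u j = c" if "i \<in> I" "j \<in> I" "i \<noteq> j" for i j
    using orthocenter_inner_const[OF injI _ orthocenter[unfolded VI]] d2 cardI
    unfolding u_def by auto
  define q where "q i = (norm (u i))\<^sup>2 - c" for i
  \<comment> \<open>Pairing \<open>\<Sum> a i *\<^sub>R u i = 0\<close> with \<open>u i\<close> ties the barycentric coordinates to the Gram matrix.\<close>
  have sum_au: "(\<Sum>i\<in>I. a i *\<^sub>R u i) = 0"
    using barycentric(1) sum_a
    by (simp add: u_def I_def scaleR_diff_right sum_subtractf flip: scaleR_sum_left)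
  have aq: "a i * q i = - c" if "i \<in> I" for i
    using inner_affine_combination[of I u c a i, OF finI c sum_a that] sum_au
    by (simp add: q_def power2_norm_eq_inner)
  have u_nz: "u i \<noteq> 0" if "i \<in> I" for i
    using that nonrectangular orthocenter VI by (auto simp: u_def rectangular_def)
  \<comment> \<open>If \<open>c\<close> vanished, the \<open>u i\<close> would be nonzero and orthogonal, so that all \<open>a i\<close> would be 0.\<close>
  have c_nz: "c \<noteq> 0"
  proof
    assume "c = 0"
    then have "a i = 0" if "i \<in> I" for i using aq[OF that] u_nz[OF that] by (simp add: q_def)
    then show False using sum_a by simp
  qed
  have a_nz: "a i \<noteq> 0" and q_nz: "q i \<noteq> 0" if "i \<in> I" for i
    using aq[OF that] c_nz by auto
  have q_eq: "q i = - c / a i" if "i \<in> I" for i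
    using aq[OF that] a_nz[OF that] by (simp add: field_simps)
  have a_n1: "a i \<noteq> 1" if "i \<in> I" for i
    using aq[OF that] u_nz[OF that] by (auto simp: q_def)
  have dist_sq: "(dist (A i) (A j))\<^sup>2 = q i + q j" if "i \<in> I" "j \<in> I" "i \<noteq> j" for i j
  proof -
    have "dist (A i) (A j) = norm (u i - u j)" by (simp add: u_def dist_norm)
    then show ?thesis using c[OF that]
      by (simp add: q_def power2_norm_eq_inner inner_simps inner_commute)
  qed
  have q_pair: "0 < q i + q j" if "i \<in> I" "j \<in> I" "i \<noteq> j" for i j
  proof -
    have "dist (A i) (A j) > 0" using injI that by (auto dest: inj_onD)
    then show ?thesis using dist_sq[OF that] by (metis zero_less_power)
  qed

  obtain r where r: "\<And>v. v \<in> V \<Longrightarrow> has_circumradius (V - {v}) r"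
    using equiradial by (auto simp: equiradial_def)
  define Q where "Q = (\<Sum>i\<in>I. q i)"
  \<comment> \<open>The facet opposite \<open>A k\<close> has \<open>\<Sum> 1 / q i = - (1 - a k) / c\<close> and \<open>\<Sum> q i = Q - q k = Q + c / a k\<close>.\<close>
  have facet: "4 * r\<^sup>2 * (1 - a k) = (1 - a k) * (Q + c / a k) + c * (real d - 2)\<^sup>2"
    if k: "k \<in> I" for k
  proof -
    let ?J = "I - {k}"
    have J: "V - {A k} = A ` ?J" using VI injI k by (auto dest: inj_onD)
    obtain z where z: "z \<in> affine hull (A ` ?J)" "\<And>i. i \<in> ?J \<Longrightarrow> dist z (A i) = r"
      using r[of "A k"] k VI unfolding has_circumradius_def J by auto
    obtain b where b: "(\<Sum>i\<in>?J. b i) = 1" "z - H = (\<Sum>i\<in>?J. b i *\<^sub>R u i)"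
      unfolding u_def
      using affine_hull_image_translated[OF _ inj_on_subset[OF injI] z(1)] finI
      by (metis Diff_subset finite_Diff)
    have "4 * r\<^sup>2 * (\<Sum>i\<in>?J. 1 / q i)
          = (\<Sum>i\<in>?J. 1 / q i) * (\<Sum>i\<in>?J. q i) - (real (card ?J) - 2)\<^sup>2"
      unfolding q_def
    proof (rule circumradius_const_inner[OF _ _ _ b])
      show "norm (z - H - u i) = r" if "i \<in> ?J" for i
        using z(2)[OF that] by (simp add: u_def dist_norm)
    qed (use finI c q_nz in \<open>auto simp: q_def\<close>)
    moreover have "(\<Sum>i\<in>?J. 1 / q i) = (1 - a k) * (- 1 / c)"
    proof -
      have "(\<Sum>i\<in>?J. 1 / q i) = (\<Sum>i\<in>?J. a i * (- 1 / c))"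
        by (intro sum.cong refl) (simp add: q_eq)
      also have "\<dots> = (1 - a k) * (- 1 / c)"
        unfolding sum_distrib_right[symmetric] using finI k sum_a by (simp add: sum_diff1)
      finally show ?thesis .
    qed
    moreover have "(\<Sum>i\<in>?J. q i) = Q + c / a k"
      using finI k q_eq[OF k] by (simp add: Q_def sum_diff1)
    moreover have "real (card ?J) = real d" using cardI k by simp
    ultimately have scaled: "4 * r\<^sup>2 * ((1 - a k) * (- 1 / c))
                     = (1 - a k) * (- 1 / c) * (Q + c / a k) - (real d - 2)\<^sup>2"
      by simp
    have "R * w = w * K + c * s" if "R * (w * (- 1 / c)) = w * (- 1 / c) * K - s" for R w K s
      using that c_nz by (simp add: field_simps)
    from this[OF scaled] show ?thesis .
  qed
  have rel: "(real d - 2)\<^sup>2 * a i * a j = (1 - a i) * (1 - a j)"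
    if "i \<in> I" "j \<in> I" "a i \<noteq> a j" for i j
    by (rule equiradial_value_relation[OF c_nz a_nz[OF that(1)] a_nz[OF that(2)] that(3)
          facet[OF that(1)] facet[OF that(2)]])

  have "\<exists>i\<in>I. \<exists>j\<in>I. a i \<noteq> a j"
  proof (rule ccontr)
    assume all_eq: "\<not> ?thesis"
    have one: "1 \<in> I" by (simp add: I_def)
    have "q i = q 1" if i: "i \<in> I" for i
    proof -
      have "a i = a 1" using all_eq i one by blast
      then show ?thesis by (simp only: q_eq[OF i] q_eq[OF one])
    qed
    then have "(dist (A i) (A j))\<^sup>2 = 2 * q 1" if "i \<in> I" "j \<in> I" "i \<noteq> j" for i j
      using dist_sq[OF that] that by simp
    then have "dist (A i) (A j) = sqrt (2 * q 1)" if "i \<in> I" "j \<in> I" "i \<noteq> j" for i j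
      using that by (metis real_sqrt_unique zero_le_dist)
    then have "regular_of_edge_length V (sqrt (2 * q 1))"
      unfolding regular_of_edge_length_def VI by blast
    then show False using nonregular by (auto simp: regular_simplex_def)
  qed
  then obtain e f where ef: "e \<in> I" "f \<in> I" "a e \<noteq> a f" by blast
  have two: "a i = a e \<or> a i = a f" if "i \<in> I" for i
  proof (rule ccontr)
    assume "\<not> ?thesis"
    then have "a e \<noteq> a i" "a f \<noteq> a i" by auto
    with ef that show False
      by (intro equiradial_at_most_two_values[OF ef(3) _ _ rel rel rel]) auto
  qed
  define level where "level x = {i \<in> I. a i = x}" for x
  have fin_level: "finite (level x)" for x using finI by (simp add: level_def)
  have I_split: "I = level (a e) \<union> level (a f)" "level (a e) \<inter> level (a f) = {}"
    using two ef by (auto simp: level_def)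
  have card_levels: "card (level (a e)) + card (level (a f)) = d + 1"
    using I_split fin_level cardI by (metis card_Un_disjoint)
  have sum_levels: "real (card (level (a e))) * a e + real (card (level (a f))) * a f = 1"
  proof -
    have "(\<Sum>i\<in>level x. a i) = real (card (level x)) * x" for x by (simp add: level_def)
    then show ?thesis using sum_a sum.union_disjoint[OF fin_level fin_level I_split(2), of a] I_split(1)
      by simp
  qed
  have level_pos: "card (level (a i)) \<ge> 1" if "i \<in> I" for i
    using that fin_level[of "a i"] by (auto simp: level_def Suc_le_eq card_gt_0_iff)
  \<comment> \<open>A repeated value comes with an edge of squared length \<open>2 * q i\<close>.\<close>
  have q_pos: "0 < q i" if i: "i \<in> I" and two: "2 \<le> card (level (a i))" for i
  proof -
    have "\<not> level (a i) \<subseteq> {i}" using two card_mono[of "{i}" "level (a i)"] by auto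
    then obtain j where "j \<in> I" "a j = a i" "j \<noteq> i" by (auto simp: level_def)
    then show ?thesis using q_pair[OF i, of j] q_eq[of j] q_eq[OF i] by simp
  qed

  \<comment> \<open>The apex is \<open>A p\<close>, and \<open>q g\<close> is the common value of \<open>q\<close> on the base. Then \<open>s\<^sup>2 = 2 * q g\<close> and
    \<open>t\<^sup>2 = q p + q g\<close>. Either of the two values can be the one at the apex.\<close>
  have kite: "kite_of_eccentricity V (sqrt ((real d - 2) / real d)) \<and> d \<ge> 5"
    if p: "p \<in> I" and g: "g \<in> I" and one: "card (level (a p)) = 1"
      and all: "card (level (a g)) = d" and sum: "a p + real d * a g = 1" and ne: "a p \<noteq> a g"
      and val: "\<And>i. i \<in> I \<Longrightarrow> a i = a p \<or> a i = a g" for p g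
  proof -
    note ratio = kite_ratio[OF d2 a_nz[OF p] a_nz[OF g] a_n1[OF p] a_n1[OF g] sum rel[OF p g ne]]
    have base: "a i = a g" if "i \<in> I" "i \<noteq> p" for i
    proof (rule ccontr)
      assume "a i \<noteq> a g"
      then have "{i, p} \<subseteq> level (a p)" using val that p by (auto simp: level_def)
      then have "card {i, p} \<le> 1" using one card_mono[OF fin_level] by metis
      then show False using that by simp
    qed
    have qb: "q i = q g" if "i \<in> I" "i \<noteq> p" for i
      using base[OF that] q_eq[OF that(1)] q_eq[OF g] by simp
    have qg: "0 < q g" using q_pos[OF g] all d2 by simp
    have "q p / q g = a g / a p"
      using c_nz a_nz[OF p] a_nz[OF g] by (simp add: q_eq[OF p] q_eq[OF g])
    then have ratio': "q p / q g = (real d - 4) / real d" using ratio(2) by simp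
    have edge: "dist (A i) (A j) = sqrt (q i + q j)" if "i \<in> I" "j \<in> I" "i \<noteq> j" for i j
      using dist_sq[OF that] by (metis real_sqrt_unique zero_le_dist)
    have Vp: "V - {A p} = A ` (I - {p})" using VI injI p by (auto dest: inj_onD)
    have "is_kite V (A p) (sqrt (2 * q g)) (sqrt (q p + q g))"
      unfolding is_kite_def regular_of_edge_length_def Vp
    proof (intro conjI ballI impI)
      show "A p \<in> V" using p VI by simp
      show "0 < sqrt (2 * q g)" using qg by simp
      show "dist x y = sqrt (2 * q g)"
        if "x \<in> A ` (I - {p})" "y \<in> A ` (I - {p})" "x \<noteq> y" for x y
        using that edge qb by fastforce
      show "dist (A p) x = sqrt (q p + q g)" if "x \<in> A ` (I - {p})" for x
        using that edge[OF p] qb by fastforce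
    qed
    moreover have "sqrt ((real d - 2) / real d) = sqrt (q p + q g) / sqrt (2 * q g)"
    proof -
      have "(q p + q g) / (2 * q g) = (q p / q g + 1) / 2" using qg by (simp add: field_simps)
      also have "\<dots> = (real d - 2) / real d" unfolding ratio' using d2 by (simp add: field_simps)
      finally show ?thesis by (simp flip: real_sqrt_divide)
    qed
    ultimately show ?thesis using ratio(1) unfolding kite_of_eccentricity_def by blast
  qed

  define m where "m = card (level (a e))"
  consider "m = 1" | "m = d" | "2 \<le> m" "m \<le> d - 1"
    using level_pos[OF ef(1)] level_pos[OF ef(2)] card_levels unfolding m_def by linarith
  then show ?thesis
  proof cases
    case 1
    then show ?thesis
      using kite[OF ef(1,2)] card_levels sum_levels ef(3) two by (auto simp: m_def)
  next
    case 2
    then show ?thesis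
      using kite[OF ef(2,1)] card_levels sum_levels ef(3) two by (auto simp: m_def)
  next
    case 3
    define k where "k = card (level (a f))"
    have mk: "m + k = d + 1" using card_levels by (simp add: m_def k_def)
    then have k: "real k = real d + 1 - real m" by linarith
    have k2: "2 \<le> k" using mk 3 by linarith
    have "0 < q e * q f" using q_pos ef 3 k2 by (simp add: m_def k_def)
    then have pos: "0 < a e * a f"
      using c_nz by (simp add: q_eq[OF ef(1)] q_eq[OF ef(2)] zero_less_mult_iff zero_less_divide_iff)
    have bounds: "2 * (real m * real k) < (real d)\<^sup>2 - 3 * real d + 4"
      "4 * (real m * real k) * (real d - 2)\<^sup>2 \<le> ((real d)\<^sup>2 - 3 * real d + 4)\<^sup>2"
      using two_value_bounds[OF _ _ _ pos _ rel[OF ef], of "real m" "real k"] 3 k2 k sum_levels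
      by (simp_all add: m_def k_def)
    have d9: "9 \<le> d" using two_value_dim_ge_9[OF 3] bounds unfolding k by blast
    have "real m * (real d + 1 - real m) \<le> (((real d)\<^sup>2 - 3 * real d + 4) / (2 * (real d - 2)))\<^sup>2"
    proof -
      have "0 < 4 * (real d - 2)\<^sup>2" using d9 by simp
      moreover have "(2 * (real d - 2))\<^sup>2 = 4 * (real d - 2)\<^sup>2"
        unfolding power_mult_distrib by simp
      ultimately show ?thesis
        using bounds(2) unfolding k power_divide by (simp only: pos_le_divide_eq mult_ac)
    qed
    moreover obtain \<pi> where \<pi>: "\<pi> permutes {1..d + 1}" "\<pi> ` {1..m} = level (a e)"
      "\<pi> ` {m + 1..d + 1} = {1..d + 1} - level (a e)"
    proof (rule permutes_initial_segment)
      show "level (a e) \<subseteq> {1..d + 1}" by (auto simp: level_def I_def)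
      show "card (level (a e)) = m" by (simp add: m_def)
    qed
    have left: "a (\<pi> i) = a e" if "i \<in> {1..m}" for i
      using \<pi>(2) that by (auto simp: level_def)
    have right: "a (\<pi> i) = a f" if "i \<in> {m + 1..d + 1}" for i
    proof -
      have "\<pi> i \<in> {1..d + 1} - level (a e)" using \<pi>(3) that by blast
      then show ?thesis using two by (auto simp: level_def I_def)
    qed
    have "(\<forall>i\<in>{1..m}. a (\<pi> i) = a (\<pi> 1)) \<and> (\<forall>i\<in>{m + 1..d + 1}. a (\<pi> i) = a (\<pi> (m + 1)))"
      using left right 3 mk k2 by simp
    ultimately show ?thesis using 3 d9 \<pi>(1) by blast
  qed
qed

end
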